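(* For every finite simplicial graph $\Gamma$, there exists an injective group homomorphism from the right-angled Artin group $A(\Gamma)$ into $\operatorname{Diff}^\infty_+(\mathbb{R})$.
   Context: For a finite simplicial graph $\Gamma$ with vertex set $V(\Gamma)$ and edge set $E(\Gamma)$, the right-angled Artin group $A(\Gamma)$ is the group with generating set $V(\Gamma)$ and defining relations $[v_i,v_j]=1$ for exactly those pairs of vertices with $\{v_i,v_j\}\in E(\Gamma)$. $\operatorname{Diff}^\infty_+(\mathbb{R})$ denotes the group of orientation preserving $C^\infty$ diffeomorphisms of $\mathbb{R}$ under composition. *)

theory Defs
  imports "HOL-Analysis.Analysis" "HOL-Algebra.Group"
begin

section \<open>Finite simplicial graphs\<close>

text \<open>Edges are two-element sets of vertices, which excludes loops and multiple edges.\<close>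

definition finite_simplicial_graph :: "'a set \<Rightarrow> 'a set set \<Rightarrow> bool" where
  "finite_simplicial_graph V E \<longleftrightarrow> finite V \<and> (\<forall>e\<in>E. e \<subseteq> V \<and> card e = 2)"


section \<open>Groups given by generators and relators\<close>

text \<open>A letter \<open>(s, True)\<close> stands for the generator \<open>s\<close> and \<open>(s, False)\<close> for its formal inverse.\<close>

type_synonym 'a word = "('a \<times> bool) list"

definition words :: "'a set \<Rightarrow> 'a word set" where
  "words S = lists (S \<times> UNIV)"

inductive_set pres_rel :: "'a set \<Rightarrow> 'a word set \<Rightarrow> ('a word \<times> 'a word) set"
  for S :: "'a set" and R :: "'a word set" where
  refl: "w \<in> words S \<Longrightarrow> (w, w) \<in> pres_rel S R"
| sym: "(w, w') \<in> pres_rel S R \<Longrightarrow> (w', w) \<in> pres_rel S R"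
| trans: "(w, w') \<in> pres_rel S R \<Longrightarrow> (w', w'') \<in> pres_rel S R \<Longrightarrow> (w, w'') \<in> pres_rel S R"
| cancel: "u \<in> words S \<Longrightarrow> v \<in> words S \<Longrightarrow> s \<in> S \<Longrightarrow>
    (u @ [(s, b), (s, \<not> b)] @ v, u @ v) \<in> pres_rel S R"
| relator: "u \<in> words S \<Longrightarrow> v \<in> words S \<Longrightarrow> r \<in> R \<Longrightarrow> r \<in> words S \<Longrightarrow>
    (u @ r @ v, u @ v) \<in> pres_rel S R"

text \<open>The group \<open>\<langle>S | R\<rangle>\<close>. The union in the product is over all pairs of
  representatives; all of them yield the same class (\<open>presented_mult\<close> below).\<close>

definition presented_group :: "'a set \<Rightarrow> 'a word set \<Rightarrow> 'a word set monoid" where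
  "presented_group S R =
    \<lparr>carrier = words S // pres_rel S R,
     mult = (\<lambda>A B. \<Union>u\<in>A. \<Union>v\<in>B. pres_rel S R `` {u @ v}),
     one = pres_rel S R `` {[]}\<rparr>"

definition commutator_word :: "'a \<Rightarrow> 'a \<Rightarrow> 'a word" where
  "commutator_word a b = [(a, True), (b, True), (a, False), (b, False)]"

definition RAAG :: "'a set \<Rightarrow> 'a set set \<Rightarrow> 'a word set monoid" where
  "RAAG V E = presented_group V {commutator_word a b | a b. {a, b} \<in> E}"


subsection \<open>A presented group is a group\<close>

lemma words_Nil [simp]: "[] \<in> words S"
  and words_Cons [simp]: "x # w \<in> words S \<longleftrightarrow> fst x \<in> S \<and> w \<in> words S"
  and words_append [simp]: "u @ v \<in> words S \<longleftrightarrow> u \<in> words S \<and> v \<in> words S"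
  by (cases x; auto simp: words_def)+

lemma pres_rel_words: "(w, w') \<in> pres_rel S R \<Longrightarrow> w \<in> words S \<and> w' \<in> words S"
  by (induction rule: pres_rel.induct) auto

lemma equiv_pres_rel: "equiv (words S) (pres_rel S R)"
proof (rule equivI)
  show "pres_rel S R \<subseteq> words S \<times> words S"
    using pres_rel_words by fast
  show "refl_on (words S) (pres_rel S R)"
    by (simp add: refl_on_def pres_rel.refl)
  show "sym (pres_rel S R)"
    by (meson pres_rel.sym symI)
  show "trans (pres_rel S R)"
    by (meson pres_rel.trans transI)
qed

lemma pres_rel_context:
  assumes "(w, w') \<in> pres_rel S R" "x \<in> words S" "y \<in> words S"
  shows "(x @ w @ y, x @ w' @ y) \<in> pres_rel S R"
  using assms(1)
proof (induction rule: pres_rel.induct)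
  case (refl w)
  then show ?case using assms(2,3) by (simp add: pres_rel.refl)
next
  case (sym w w')
  then show ?case by (blast intro: pres_rel.sym)
next
  case (trans w w' w'')
  then show ?case by (blast intro: pres_rel.trans)
next
  case (cancel u v s b)
  then show ?case using assms(2,3) pres_rel.cancel[of "x @ u" S "v @ y" s b R] by simp
next
  case (relator u v r)
  then show ?case using assms(2,3) pres_rel.relator[of "x @ u" S "v @ y" r R] by simp
qed

lemma pres_rel_append:
  assumes "(u, u') \<in> pres_rel S R" "(v, v') \<in> pres_rel S R"
  shows "(u @ v, u' @ v') \<in> pres_rel S R"
proof -
  have "(u @ v, u' @ v) \<in> pres_rel S R"
    using pres_rel_context[of u u' S R "[]" v] assms pres_rel_words by fastforce
  moreover have "(u' @ v, u' @ v') \<in> pres_rel S R"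
    using pres_rel_context[of v v' S R u' "[]"] assms pres_rel_words by fastforce
  ultimately show ?thesis by (rule pres_rel.trans)
qed

lemma presented_mult:
  assumes "u \<in> words S" "v \<in> words S"
  shows "pres_rel S R `` {u} \<otimes>\<^bsub>presented_group S R\<^esub> pres_rel S R `` {v} = pres_rel S R `` {u @ v}"
proof -
  have "pres_rel S R `` {u' @ v'} = pres_rel S R `` {u @ v}"
    if "u' \<in> pres_rel S R `` {u}" "v' \<in> pres_rel S R `` {v}" for u' v'
    using that equiv_class_eq[OF equiv_pres_rel pres_rel_append[of u u' S R v v']] by simp
  then have "(\<Union>u'\<in>pres_rel S R `` {u}. \<Union>v'\<in>pres_rel S R `` {v}. pres_rel S R `` {u' @ v'}) =
      (\<Union>u'\<in>pres_rel S R `` {u}. \<Union>v'\<in>pres_rel S R `` {v}. pres_rel S R `` {u @ v})"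
    by (intro SUP_cong HOL.refl)
  moreover have "u \<in> pres_rel S R `` {u}" "v \<in> pres_rel S R `` {v}"
    using assms by (simp_all add: pres_rel.refl)
  then have "pres_rel S R `` {u} \<noteq> {}" "pres_rel S R `` {v} \<noteq> {}"
    by (metis empty_iff)+
  ultimately show ?thesis
    unfolding presented_group_def by simp
qed

definition inverse_word :: "'a word \<Rightarrow> 'a word" where
  "inverse_word w = rev (map (\<lambda>(s, b). (s, \<not> b)) w)"

lemma inverse_word_in_words [simp]: "inverse_word w \<in> words S \<longleftrightarrow> w \<in> words S"
  by (induction w) (auto simp: inverse_word_def split: prod.splits)

lemma inverse_word_left:
  "w \<in> words S \<Longrightarrow> (inverse_word w @ w, []) \<in> pres_rel S R"
proof (induction w)
  case Nil
  then show ?case by (simp add: inverse_word_def pres_rel.refl)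
next
  case (Cons x w)
  obtain s b where x: "x = (s, b)" by fastforce
  have "(inverse_word w @ [(s, \<not> b), (s, \<not> \<not> b)] @ w, inverse_word w @ w) \<in> pres_rel S R"
    using Cons.prems x by (intro pres_rel.cancel) auto
  moreover have "inverse_word (x # w) @ x # w = inverse_word w @ [(s, \<not> b), (s, \<not> \<not> b)] @ w"
    by (simp add: x inverse_word_def)
  ultimately show ?case
    using Cons pres_rel.trans by fastforce
qed

theorem group_presented_group: "group (presented_group S R)"
proof (rule groupI)
  have cE: "\<exists>w\<in>words S. A = pres_rel S R `` {w}" if "A \<in> carrier (presented_group S R)" for A
    using that by (auto simp: presented_group_def elim: quotientE)
  have cI: "pres_rel S R `` {w} \<in> carrier (presented_group S R)" if "w \<in> words S" for w
    using that by (simp add: presented_group_def quotientI)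
  have one: "\<one>\<^bsub>presented_group S R\<^esub> = pres_rel S R `` {[]}"
    by (simp add: presented_group_def)
  show "\<one>\<^bsub>presented_group S R\<^esub> \<in> carrier (presented_group S R)"
    by (simp add: one cI)
  fix x assume "x \<in> carrier (presented_group S R)"
  then obtain u where u: "u \<in> words S" "x = pres_rel S R `` {u}" using cE by blast
  show "\<one>\<^bsub>presented_group S R\<^esub> \<otimes>\<^bsub>presented_group S R\<^esub> x = x"
    by (simp add: one u presented_mult)
  have "pres_rel S R `` {inverse_word u @ u} = pres_rel S R `` {[]}"
    using u equiv_class_eq[OF equiv_pres_rel inverse_word_left] by blast
  then show "\<exists>y\<in>carrier (presented_group S R).
      y \<otimes>\<^bsub>presented_group S R\<^esub> x = \<one>\<^bsub>presented_group S R\<^esub>"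
    using u by (intro bexI[of _ "pres_rel S R `` {inverse_word u}"]) (auto simp: one presented_mult cI)
  fix y assume "y \<in> carrier (presented_group S R)"
  then obtain v where v: "v \<in> words S" "y = pres_rel S R `` {v}" using cE by blast
  show "x \<otimes>\<^bsub>presented_group S R\<^esub> y \<in> carrier (presented_group S R)"
    by (simp add: u v presented_mult cI)
  fix z assume "z \<in> carrier (presented_group S R)"
  then obtain w where w: "w \<in> words S" "z = pres_rel S R `` {w}" using cE by blast
  show "x \<otimes>\<^bsub>presented_group S R\<^esub> y \<otimes>\<^bsub>presented_group S R\<^esub> z =
      x \<otimes>\<^bsub>presented_group S R\<^esub> (y \<otimes>\<^bsub>presented_group S R\<^esub> z)"
    by (simp add: u v w presented_mult)
qed

corollary group_RAAG: "group (RAAG V E)"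
  unfolding RAAG_def by (rule group_presented_group)


section \<open>Orientation preserving smooth diffeomorphisms of the line\<close>

definition smooth :: "(real \<Rightarrow> real) \<Rightarrow> bool" where
  "smooth f \<longleftrightarrow> (\<forall>n x. (deriv ^^ n) f differentiable (at x))"

definition diffeomorphism :: "(real \<Rightarrow> real) \<Rightarrow> bool" where
  "diffeomorphism f \<longleftrightarrow> bij f \<and> smooth f \<and> smooth (inv_into UNIV f)"

definition orientation_preserving :: "(real \<Rightarrow> real) \<Rightarrow> bool" where
  "orientation_preserving f \<longleftrightarrow> (\<forall>x. deriv f x > 0)"

definition Diff_plus :: "(real \<Rightarrow> real) monoid" where
  "Diff_plus =
    \<lparr>carrier = {f. diffeomorphism f \<and> orientation_preserving f}, mult = (\<circ>), one = id\<rparr>"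


subsection \<open>These diffeomorphisms form a group\<close>

definition differentiable_upto :: "nat \<Rightarrow> (real \<Rightarrow> real) \<Rightarrow> bool" where
  "differentiable_upto n f \<longleftrightarrow> (\<forall>k\<le>n. \<forall>x. (deriv ^^ k) f differentiable (at x))"

lemma smooth_iff: "smooth f \<longleftrightarrow> (\<forall>n. differentiable_upto n f)"
  by (auto simp: smooth_def differentiable_upto_def)

lemma differentiable_upto_0: "differentiable_upto 0 f \<longleftrightarrow> (\<forall>x. f differentiable (at x))"
  by (simp add: differentiable_upto_def)

lemma differentiable_upto_Suc:
  "differentiable_upto (Suc n) f \<longleftrightarrow> (\<forall>x. f differentiable (at x)) \<and> differentiable_upto n (deriv f)"
proof -
  have *: "(deriv ^^ Suc k) f = (deriv ^^ k) (deriv f)" for k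
    by (simp only: funpow_Suc_right o_apply)
  have "(\<forall>k\<le>Suc n. P k) \<longleftrightarrow> P 0 \<and> (\<forall>k\<le>n. P (Suc k))" for P
    by (metis Suc_le_mono le0 not0_implies_Suc)
  from this[of "\<lambda>k. \<forall>x. (deriv ^^ k) f differentiable (at x)"] show ?thesis
    unfolding differentiable_upto_def * by simp
qed

lemma differentiable_upto_mono: "differentiable_upto (Suc n) f \<Longrightarrow> differentiable_upto n f"
  by (simp add: differentiable_upto_def)

lemma differentiable_upto_add:
  "differentiable_upto n f \<Longrightarrow> differentiable_upto n g \<Longrightarrow> differentiable_upto n (\<lambda>x. f x + g x)"
proof (induction n arbitrary: f g)
  case 0
  then show ?case by (simp add: differentiable_upto_0)
next
  case (Suc n)
  then have "deriv (\<lambda>x. f x + g x) = (\<lambda>x. deriv f x + deriv g x)"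
    by (intro ext deriv_add)
      (auto simp: differentiable_upto_Suc field_differentiable_def real_differentiable_def)
  with Suc show ?case by (simp add: differentiable_upto_Suc)
qed

lemma differentiable_upto_mult:
  "differentiable_upto n f \<Longrightarrow> differentiable_upto n g \<Longrightarrow> differentiable_upto n (\<lambda>x. f x * g x)"
proof (induction n arbitrary: f g)
  case 0
  then show ?case by (simp add: differentiable_upto_0)
next
  case (Suc n)
  then have "deriv (\<lambda>x. f x * g x) = (\<lambda>x. f x * deriv g x + deriv f x * g x)"
    by (intro ext deriv_mult)
      (auto simp: differentiable_upto_Suc field_differentiable_def real_differentiable_def)
  with Suc show ?case
    using differentiable_upto_mono[OF Suc.prems(1)] differentiable_upto_mono[OF Suc.prems(2)]
    by (simp add: differentiable_upto_Suc differentiable_upto_add)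
qed

lemma deriv_compose:
  fixes f g :: "real \<Rightarrow> real"
  assumes "\<And>x. f differentiable (at x)" "\<And>x. g differentiable (at x)"
  shows "deriv (f \<circ> g) = (\<lambda>x. deriv f (g x) * deriv g x)"
  using assms by (intro ext deriv_chain) (auto simp: field_differentiable_def real_differentiable_def)

lemma differentiable_upto_compose:
  "differentiable_upto n f \<Longrightarrow> differentiable_upto n g \<Longrightarrow> differentiable_upto n (f \<circ> g)"
proof (induction n arbitrary: f g)
  case 0
  then show ?case unfolding differentiable_upto_0 by (blast intro: differentiable_chain_at)
next
  case (Suc n)
  then have d: "f differentiable (at x)" "g differentiable (at x)" for x
    by (auto simp: differentiable_upto_Suc)
  have "differentiable_upto n (\<lambda>x. (deriv f \<circ> g) x * deriv g x)"
    using Suc differentiable_upto_mono[OF Suc.prems(2)]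
    by (intro differentiable_upto_mult) (auto simp: differentiable_upto_Suc)
  then have "differentiable_upto n (deriv (f \<circ> g))"
    by (simp add: deriv_compose d)
  moreover have "(f \<circ> g) differentiable (at x)" for x
    using d by (blast intro: differentiable_chain_at)
  ultimately show ?case
    unfolding differentiable_upto_Suc by blast
qed

lemma smooth_compose: "smooth f \<Longrightarrow> smooth g \<Longrightarrow> smooth (f \<circ> g)"
  by (simp add: smooth_iff differentiable_upto_compose)

lemma smooth_imp_differentiable: "smooth f \<Longrightarrow> f differentiable (at x)"
  unfolding smooth_def by (metis funpow_0)

lemma differentiable_upto_const: "differentiable_upto n (\<lambda>x. c)"
  by (induction n arbitrary: c) (simp_all add: differentiable_upto_0 differentiable_upto_Suc)

lemma smooth_id: "smooth id"
proof -
  have "differentiable_upto n id" for n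
    by (cases n) (auto simp: differentiable_upto_0 differentiable_upto_Suc differentiable_upto_const id_def)
  then show ?thesis by (simp add: smooth_iff)
qed

theorem group_Diff_plus: "group Diff_plus"
proof (rule groupI)
  fix f assume f: "f \<in> carrier Diff_plus"
  then have bf: "bij f" "smooth f" "smooth (inv_into UNIV f)" "\<And>x. deriv f x > 0"
    by (auto simp: Diff_plus_def diffeomorphism_def orientation_preserving_def)
  have fi: "f \<circ> inv_into UNIV f = id" "inv_into UNIV f \<circ> f = id"
    using bf(1) by (auto simp: bij_def simp flip: surj_iff)
  have "deriv f (inv_into UNIV f x) * deriv (inv_into UNIV f) x = 1" for x
    using deriv_compose[of f "inv_into UNIV f"] bf fi(1)
    by (metis (no_types, lifting) deriv_id id_def smooth_imp_differentiable)
  then have "deriv (inv_into UNIV f) x > 0" for x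
    by (metis bf(4) zero_less_mult_pos zero_less_one)
  then have "inv_into UNIV f \<in> carrier Diff_plus"
    using bf by (simp add: Diff_plus_def diffeomorphism_def orientation_preserving_def
        bij_imp_bij_inv inv_inv_eq)
  then show "\<exists>g\<in>carrier Diff_plus. g \<otimes>\<^bsub>Diff_plus\<^esub> f = \<one>\<^bsub>Diff_plus\<^esub>"
    using fi by (auto simp: Diff_plus_def)
  fix g assume g: "g \<in> carrier Diff_plus"
  then have bg: "bij g" "smooth g" "smooth (inv_into UNIV g)" "\<And>x. deriv g x > 0"
    by (auto simp: Diff_plus_def diffeomorphism_def orientation_preserving_def)
  show "f \<otimes>\<^bsub>Diff_plus\<^esub> g \<in> carrier Diff_plus"
    using bf bg
    by (auto simp: Diff_plus_def diffeomorphism_def orientation_preserving_def deriv_compose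
        smooth_imp_differentiable smooth_compose o_inv_distrib bij_comp)
next
  have "deriv id x = 1" for x :: real
    by (simp add: id_def)
  moreover have "inv_into UNIV id = (id :: real \<Rightarrow> real)"
    by (rule inv_id)
  ultimately show "\<one>\<^bsub>Diff_plus\<^esub> \<in> carrier Diff_plus"
    by (simp add: Diff_plus_def diffeomorphism_def orientation_preserving_def smooth_id)
qed (simp_all add: Diff_plus_def comp_assoc)

end

theory Submission
  imports Defs "HOL-Algebra.Coset"
begin

text \<open>
  Call a word reduced if it contains no letter \<open>a\<close> and a later inverse \<open>a\<inverse>\<close> with only letters
  adjacent to \<open>a\<close> in between. Every element of \<open>A(\<Gamma>)\<close> is represented by a reduced word, so it
  suffices to find, for each nonempty reduced word \<open>w\<close>, diffeomorphisms supported in \<open>[1/4, 3/4]\<close>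
  that satisfy the relations and are such that \<open>w\<close> moves a point. As there are countably many
  words, these actions can be placed side by side in the intervals \<open>[n, n + 1]\<close>.

  For a given \<open>w\<close>, follow the trajectory of a point. The first letter acts by a bump that pushes
  the point to the right. Whenever the next letter is distinct from and not adjacent to the letter
  \<open>s\<close> of the current bump, it receives a new bump whose support overlaps that of the current one
  only near its right end and is disjoint from all earlier ones; the new bump pushes the point
  beyond the support of the current bump. Until then, letters adjacent to \<open>s\<close> fix the point, and
  occurrences of \<open>s\<close> have the same sign because \<open>w\<close> is reduced, so they only push the point
  further right. Only consecutive bumps overlap, and these carry non-commuting generators, so adjacent
  generators get disjoint supports.
\<close>

section \<open>Smooth bump diffeomorphisms\<close>

lemma poly_exp_tendsto_0:
  fixes p :: "real poly"
  shows "((\<lambda>t. poly p t * exp (- t)) \<longlongrightarrow> 0) at_top"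
proof -
  have "((\<lambda>t. \<Sum>i\<le>degree p. coeff p i * (t ^ i / exp t)) \<longlongrightarrow> (\<Sum>i\<le>degree p. coeff p i * 0)) at_top"
    by (intro tendsto_intros tendsto_power_div_exp_0)
  moreover have "(\<lambda>t. \<Sum>i\<le>degree p. coeff p i * (t ^ i / exp t)) = (\<lambda>t. poly p t * exp (- t))"
    by (simp add: poly_altdef sum_distrib_right exp_minus divide_inverse mult.assoc)
  ultimately show ?thesis by simp
qed

text \<open>Allowing a polynomial factor makes the class of exp(-1/x)-type flat functions closed
  under differentiation, so smoothness follows by induction; \<open>flat 1\<close> is the classical
  example.\<close>

definition flat :: "real poly \<Rightarrow> real \<Rightarrow> real" where
  "flat p x = (if x > 0 then poly p (1 / x) * exp (- (1 / x)) else 0)"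

text \<open>In t = 1/x, d/dx is -t^2 d/dt, which turns p(t) exp(-t) into t^2 (p - p')(t)
  exp(-t).\<close>

definition flat_deriv :: "real poly \<Rightarrow> real poly" where
  "flat_deriv p = [:0, 0, 1:] * (p - pderiv p)"

lemma flat_has_derivative: "(flat p has_real_derivative flat (flat_deriv p) x) (at x)"
proof (cases x "0::real" rule: linorder_cases)
  case less
  have "((\<lambda>x. 0) has_real_derivative 0) (at x)" by simp
  moreover have "eventually (\<lambda>y. 0 = flat p y) (nhds x)"
    using eventually_nhds_in_open[of "{..<0}" x] less
    by (auto elim!: eventually_mono simp: flat_def)
  ultimately show ?thesis
    using less by (simp add: flat_def DERIV_cong_ev[OF HOL.refl _ HOL.refl])
next
  case greater
  have "((\<lambda>x. poly p (1 / x) * exp (- (1 / x))) has_real_derivative flat (flat_deriv p) x) (at x)"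
    using greater
    by (auto intro!: derivative_eq_intros poly_DERIV[THEN DERIV_chain2]
        simp: flat_def flat_deriv_def field_simps power2_eq_square)
  moreover have "eventually (\<lambda>y. poly p (1 / y) * exp (- (1 / y)) = flat p y) (nhds x)"
    using eventually_nhds_in_open[of "{0<..}" x] greater
    by (auto elim!: eventually_mono simp: flat_def)
  ultimately show ?thesis
    by (simp add: DERIV_cong_ev[OF HOL.refl _ HOL.refl])
next
  case equal
  \<comment> \<open>The difference quotient at 0 from the right is t p(t) exp(-t) with t = 1/h, and
    \<open>pCons 0 p\<close> is the polynomial t p(t).\<close>
  have "((\<lambda>h. poly (pCons 0 p) (inverse h) * exp (- inverse h)) \<longlongrightarrow> 0) (at_right 0)"
    by (rule filterlim_compose[OF poly_exp_tendsto_0 filterlim_inverse_at_top_right])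
  then have "((\<lambda>h. flat p h / h) \<longlongrightarrow> 0) (at_right 0)"
    by (rule Lim_transform_eventually)
      (auto simp: eventually_at_filter flat_def field_simps)
  moreover have "((\<lambda>h. flat p h / h) \<longlongrightarrow> 0) (at_left 0)"
    by (rule Lim_transform_eventually[OF tendsto_const])
      (auto simp: eventually_at_filter flat_def)
  ultimately have "((\<lambda>h. flat p h / h) \<longlongrightarrow> 0) (at 0)"
    by (simp add: filterlim_split_at)
  with equal show ?thesis
    by (simp add: DERIV_def flat_def)
qed

lemma differentiable_upto_flat: "differentiable_upto n (flat p)"
proof (induction n arbitrary: p)
  case 0
  then show ?case
    using flat_has_derivative real_differentiable_def by (auto simp: differentiable_upto_0)
next
  case (Suc n)
  have "deriv (flat p) = flat (flat_deriv p)"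
    using flat_has_derivative DERIV_imp_deriv by blast
  with Suc show ?case
    using flat_has_derivative real_differentiable_def by (auto simp: differentiable_upto_Suc)
qed

lemma smooth_flat: "smooth (flat p)"
  by (simp add: smooth_iff differentiable_upto_flat)

section \<open>Closure properties and locality of smoothness\<close>

lemma smooth_const: "smooth (\<lambda>x. c)"
  by (simp add: smooth_iff differentiable_upto_const)

lemma smooth_ident: "smooth (\<lambda>x. x)"
  using smooth_id by (simp add: id_def)

lemma smooth_add: "smooth f \<Longrightarrow> smooth g \<Longrightarrow> smooth (\<lambda>x. f x + g x)"
  by (simp add: smooth_iff differentiable_upto_add)

lemma smooth_mult: "smooth f \<Longrightarrow> smooth g \<Longrightarrow> smooth (\<lambda>x. f x * g x)"
  by (simp add: smooth_iff differentiable_upto_mult)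

lemma smooth_affine: "smooth (\<lambda>x. a * x + b)"
  by (intro smooth_add smooth_mult smooth_const smooth_ident)

lemma smooth_deriv: "smooth f \<Longrightarrow> smooth (deriv f)"
  using differentiable_upto_Suc by (auto simp: smooth_iff)

lemma smooth_has_derivative: "smooth f \<Longrightarrow> (f has_real_derivative deriv f x) (at x)"
  using smooth_imp_differentiable DERIV_deriv_iff_real_differentiable by blast

lemma smooth_isCont: "smooth f \<Longrightarrow> isCont f x"
  using smooth_has_derivative DERIV_isCont by blast

lemma deriv_funpow_cong_ev:
  fixes f g :: "real \<Rightarrow> real"
  assumes "eventually (\<lambda>y. f y = g y) (nhds x)"
  shows "eventually (\<lambda>y. (deriv ^^ n) f y = (deriv ^^ n) g y) (nhds x)"
proof (induction n)
  case (Suc n)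
  then have "eventually (\<lambda>y. eventually (\<lambda>z. (deriv ^^ n) f z = (deriv ^^ n) g z) (nhds y)) (nhds x)"
    by (simp add: eventually_eventually)
  then show ?case
    by eventually_elim (auto intro: deriv_cong_ev)
qed (use assms in simp)

text \<open>The comparison function may vary with the point; this is what glued maps need.\<close>

lemma smooth_local:
  assumes "\<And>x. \<exists>g. smooth g \<and> eventually (\<lambda>y. f y = g y) (nhds x)"
  shows "smooth f"
  unfolding smooth_def
proof (intro allI)
  fix n x
  obtain g where g: "smooth g" "eventually (\<lambda>y. f y = g y) (nhds x)"
    using assms by blast
  have "eventually (\<lambda>y. (deriv ^^ n) f y = (deriv ^^ n) g y) (nhds x)"
    by (rule deriv_funpow_cong_ev[OF g(2)])
  moreover have "(deriv ^^ n) g differentiable (at x)"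
    using g(1) by (simp add: smooth_def)
  ultimately show "(deriv ^^ n) f differentiable (at x)"
    unfolding real_differentiable_def using DERIV_cong_ev by blast
qed

lemma differentiable_upto_inverse:
  "differentiable_upto n f \<Longrightarrow> (\<And>x. f x \<noteq> 0) \<Longrightarrow> differentiable_upto n (\<lambda>x. inverse (f x))"
proof (induction n arbitrary: f)
  case 0
  then show ?case by (simp add: differentiable_upto_0)
next
  case (Suc n)
  then have d: "(f has_real_derivative deriv f x) (at x)" for x
    by (simp add: differentiable_upto_Suc DERIV_deriv_iff_real_differentiable)
  then have d': "((\<lambda>x. inverse (f x)) has_real_derivative
      (- 1) * (deriv f x * (inverse (f x) * inverse (f x)))) (at x)" for x
    using Suc.prems(2) by (auto intro!: derivative_eq_intros simp: field_simps power2_eq_square)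
  then have "deriv (\<lambda>x. inverse (f x)) = (\<lambda>x. (- 1) * (deriv f x * (inverse (f x) * inverse (f x))))"
    using DERIV_imp_deriv by blast
  moreover have "differentiable_upto n (\<lambda>x. (- 1) * (deriv f x * (inverse (f x) * inverse (f x))))"
    using Suc differentiable_upto_mono[OF Suc.prems(1)]
    by (intro differentiable_upto_mult differentiable_upto_const)
      (auto simp: differentiable_upto_Suc)
  ultimately show ?case
    using d' unfolding differentiable_upto_Suc real_differentiable_def by metis
qed

section \<open>Criteria for membership in \<open>Diff_plus\<close>\<close>

lemma deriv_pos_strict_mono:
  assumes "smooth f" "\<And>x. deriv f x > 0"
  shows "strict_mono f"
  using assms smooth_has_derivative by (intro strict_monoI) (metis DERIV_pos_imp_increasing)

text \<open>The inverse g satisfies g' = 1 / (f' o g), so each order of differentiability of g gives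
  the next.\<close>

lemma Diff_plusI:
  assumes f: "smooth f" and pos: "\<And>x. deriv f x > 0" and "surj f"
  shows "f \<in> carrier Diff_plus"
proof -
  let ?g = "inv_into UNIV f"
  have mono: "strict_mono f"
    by (rule deriv_pos_strict_mono[OF f pos])
  then have bij: "bij f"
    using \<open>surj f\<close> by (simp add: bij_def strict_mono_imp_inj_on)
  have fg: "f (?g y) = y" for y
    using \<open>surj f\<close> by (simp add: surj_f_inv_f)
  have "isCont ?g (f x)" for x
    using bij by (intro isCont_inverse_function[where d = 1 and f = f and g = ?g]) (simp_all add: bij_is_inj smooth_isCont f)
  then have cont: "isCont ?g y" for y
    by (metis fg)
  have d: "(?g has_real_derivative inverse (deriv f (?g y))) (at y)" for y
  proof (rule DERIV_inverse_function)
    show "y - 1 < y" "y < y + 1" by simp_all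
    show "deriv f (?g y) \<noteq> 0" using pos[of "?g y"] by simp
  qed (use smooth_has_derivative[OF f] fg cont in simp_all)
  then have dg: "deriv ?g = (\<lambda>y. inverse (deriv f (?g y)))"
    using DERIV_imp_deriv by blast
  have "differentiable_upto n ?g" for n
  proof (induction n)
    case 0
    show ?case using d by (auto simp: differentiable_upto_0 real_differentiable_def)
  next
    case (Suc n)
    have "differentiable_upto n (deriv f \<circ> ?g)"
      using Suc smooth_deriv[OF f] by (simp add: differentiable_upto_compose smooth_iff)
    then have "differentiable_upto n (\<lambda>y. inverse ((deriv f \<circ> ?g) y))"
      by (rule differentiable_upto_inverse) (metis comp_apply less_irrefl pos)
    then show ?case
      using d by (auto simp: differentiable_upto_Suc dg real_differentiable_def)
  qed
  then show ?thesis
    using f bij pos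
    by (simp add: Diff_plus_def diffeomorphism_def orientation_preserving_def smooth_iff)
qed

text \<open>Arbitrarily far fixed points on both sides give surjectivity by the intermediate value
  theorem. Both maps of bounded support and maps fixing all integers are covered.\<close>

lemma Diff_plusI_fixpoints:
  assumes f: "smooth f" and pos: "\<And>x. deriv f x > 0"
    and below: "\<And>y. \<exists>a\<le>y. f a = a" and above: "\<And>y. \<exists>b\<ge>y. f b = b"
  shows "f \<in> carrier Diff_plus"
proof (rule Diff_plusI[OF f pos])
  have "\<exists>x. f x = y" for y
  proof -
    obtain a b where ab: "a \<le> y" "f a = a" "y \<le> b" "f b = b"
      using below above by blast
    then show ?thesis
      using IVT[of f a y b] smooth_isCont[OF f] by auto
  qed
  then show "surj f" by (metis surjI)
qed

lemma Diff_plus_bij: "f \<in> carrier Diff_plus \<Longrightarrow> bij f"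
  by (simp add: Diff_plus_def diffeomorphism_def)

lemma Diff_plus_strict_mono: "f \<in> carrier Diff_plus \<Longrightarrow> strict_mono f"
  by (simp add: Diff_plus_def diffeomorphism_def orientation_preserving_def deriv_pos_strict_mono)

lemma Diff_plus_id: "id \<in> carrier Diff_plus"
  using monoid.one_closed[OF group.is_monoid[OF group_Diff_plus]] by (simp add: Diff_plus_def)

lemma Diff_plus_comp: "f \<in> carrier Diff_plus \<Longrightarrow> g \<in> carrier Diff_plus \<Longrightarrow> f \<circ> g \<in> carrier Diff_plus"
  using monoid.m_closed[OF group.is_monoid[OF group_Diff_plus], of f g] by (simp add: Diff_plus_def)

lemma Diff_plus_inv:
  assumes f: "f \<in> carrier Diff_plus"
  shows "inv_into UNIV f \<in> carrier Diff_plus"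
proof -
  interpret group Diff_plus by (rule group_Diff_plus)
  have "inv\<^bsub>Diff_plus\<^esub> f \<circ> f = id" "f \<circ> inv\<^bsub>Diff_plus\<^esub> f = id"
    using l_inv[OF f] r_inv[OF f] by (simp_all add: Diff_plus_def)
  then have "inv_into UNIV f = inv\<^bsub>Diff_plus\<^esub> f"
    by (metis inv_unique_comp)
  then show ?thesis using inv_closed[OF f] by simp
qed

section \<open>Diffeomorphisms pushing points to the right\<close>

lemma exists_bump_diffeo:
  fixes l r :: real
  assumes "l < r"
  obtains h where "h \<in> carrier Diff_plus" "\<And>y. y \<le> l \<or> r \<le> y \<Longrightarrow> h y = y"
    "\<And>y. l < y \<Longrightarrow> y < r \<Longrightarrow> y < h y"
proof -
  define b where "b = (\<lambda>y. (flat 1 \<circ> (\<lambda>y. 1 * y + - l)) y * (flat 1 \<circ> (\<lambda>y. (- 1) * y + r)) y)"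
  have b: "smooth b"
    unfolding b_def by (intro smooth_mult smooth_compose smooth_flat smooth_affine)
  have b0: "b y = 0" if "y \<le> l \<or> r \<le> y" for y
    using that by (auto simp: b_def flat_def)
  have bpos: "b y > 0" if "l < y" "y < r" for y
    using that by (simp add: b_def flat_def)
  have "continuous_on {l..r} (deriv b)"
    using smooth_has_derivative[OF smooth_deriv[OF b]]
    by (meson DERIV_continuous_on has_field_derivative_at_within)
  then have "bounded (deriv b ` {l..r})"
    by (intro compact_imp_bounded compact_continuous_image) auto
  then obtain M where M: "M > 0" "\<And>y. y \<in> {l..r} \<Longrightarrow> \<bar>deriv b y\<bar> \<le> M"
    by (auto simp: bounded_pos)
  have db0: "deriv b y = 0" if "y < l \<or> r < y" for y
  proof -
    have "eventually (\<lambda>z. z \<in> {..<l} \<union> {r<..}) (nhds y)"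
      using that by (intro eventually_nhds_in_open) auto
    then have "eventually (\<lambda>z. b z = (\<lambda>z. 0) z) (nhds y)"
      by eventually_elim (auto simp: b0)
    then show ?thesis using deriv_cong_ev by fastforce
  qed
  have bound: "\<bar>deriv b y\<bar> < M + 1" for y
    using M(2)[of y] M(1) db0[of y] by (cases "y \<in> {l..r}") auto
  \<comment> \<open>The scaling by 1/(M + 1) keeps the perturbation's derivative above -1, so
    \<open>h\<close> stays increasing.\<close>
  define h where "h = (\<lambda>y. y + inverse (M + 1) * b y)"
  have dh: "deriv h y = 1 + inverse (M + 1) * deriv b y" for y
    unfolding h_def
    by (rule DERIV_imp_deriv) (auto intro!: derivative_eq_intros smooth_has_derivative b)
  have pos: "deriv h y > 0" for y
  proof -
    have "- (M + 1) < deriv b y" using bound[of y] by linarith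
    then show ?thesis using M(1) by (simp add: dh field_simps)
  qed
  have fixed: "h y = y" if "y \<le> l \<or> r \<le> y" for y
    using b0[OF that] by (simp add: h_def)
  have "h \<in> carrier Diff_plus"
  proof (rule Diff_plusI_fixpoints)
    show "smooth h"
      unfolding h_def by (intro smooth_add smooth_mult smooth_const smooth_ident b)
    show "\<exists>a\<le>y. h a = a" for y
      using fixed[of "min y l"] by (intro exI[of _ "min y l"]) simp
    show "\<exists>a\<ge>y. h a = a" for y
      using fixed[of "max y r"] by (intro exI[of _ "max y r"]) simp
  qed (rule pos)
  moreover have "y < h y" if "l < y" "y < r" for y
    using bpos[OF that] M(1) by (simp add: h_def)
  ultimately show ?thesis using that fixed by blast
qed

text \<open>The iterates of \<open>c\<close> under a bump increase to a fixed point in (l, r], which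
  can only be \<open>r\<close>; hence some iterate passes \<open>d\<close>.\<close>

lemma exists_push_diffeo:
  fixes l c d r :: real
  assumes "l < c" "c < r" "d < r"
  obtains k where "k \<in> carrier Diff_plus" "\<And>y. y \<le> l \<or> r \<le> y \<Longrightarrow> k y = y"
    "\<And>y. y \<le> k y" "d \<le> k c"
proof -
  obtain h where h: "h \<in> carrier Diff_plus" "\<And>y. y \<le> l \<or> r \<le> y \<Longrightarrow> h y = y"
    "\<And>y. l < y \<Longrightarrow> y < r \<Longrightarrow> y < h y"
    using exists_bump_diffeo[of l r] assms by auto
  have hge: "y \<le> h y" for y
    using h(2,3)[of y] by (cases "y \<le> l \<or> r \<le> y") auto
  have hN: "h ^^ n \<in> carrier Diff_plus" for n
    by (induction n) (simp_all only: funpow.simps Diff_plus_comp h(1) Diff_plus_id)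
  have fixN: "(h ^^ n) y = y" if "y \<le> l \<or> r \<le> y" for n y
    using h(2)[OF that] by (induction n) auto
  have geN: "y \<le> (h ^^ n) y" for n y
    by (induction n) (auto intro: order_trans hge)
  define X where "X n = (h ^^ n) c" for n
  have Xr: "X n < r" for n
    using strict_monoD[OF Diff_plus_strict_mono[OF hN[of n]] assms(2)] fixN[of r n]
    by (simp add: X_def)
  have "incseq X"
    by (rule incseq_SucI) (simp add: X_def hge)
  then obtain L where L: "X \<longlonglongrightarrow> L" "\<And>n. X n \<le> L"
    using incseq_convergent[of X r] Xr less_imp_le by metis
  have "L \<le> r"
    using L(1) Xr by (meson LIMSEQ_le_const2 less_imp_le)
  have "isCont h L"
    using h(1) by (simp add: Diff_plus_def diffeomorphism_def smooth_isCont)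
  then have "(\<lambda>n. h (X n)) \<longlonglongrightarrow> h L"
    by (rule isCont_tendsto_compose[OF _ L(1)])
  moreover have "(\<lambda>n. h (X n)) \<longlonglongrightarrow> L"
    using LIMSEQ_Suc[OF L(1)] by (simp add: X_def)
  ultimately have "h L = L" by (rule LIMSEQ_unique)
  moreover have "l < L" using L(2)[of 0] assms(1) by (simp add: X_def)
  ultimately have "L = r" using h(3)[of L] \<open>L \<le> r\<close> by fastforce
  then have "eventually (\<lambda>n. d < X n) sequentially"
    using order_tendstoD(1)[OF L(1)] assms(3) by blast
  then obtain N where "d < X N"
    by (auto simp: eventually_sequentially)
  then show ?thesis
    using that[of "h ^^ N"] hN fixN geN by (auto simp: X_def)
qed

section \<open>Reduced words acting on the line\<close>

definition letter_act :: "('a \<Rightarrow> 'b \<Rightarrow> 'b) \<Rightarrow> 'a \<times> bool \<Rightarrow> 'b \<Rightarrow> 'b" where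
  "letter_act F l = (if snd l then F (fst l) else inv_into UNIV (F (fst l)))"

lemma letter_act_Diff_plus: "(\<And>v. F v \<in> carrier Diff_plus) \<Longrightarrow> letter_act F l \<in> carrier Diff_plus"
  by (simp add: letter_act_def Diff_plus_inv)

lemma letter_act_fixed: "bij (F (fst l)) \<Longrightarrow> F (fst l) y = y \<Longrightarrow> letter_act F l y = y"
  by (metis bij_is_inj inv_f_eq letter_act_def)

text \<open>For an inverse letter the generator acts by the inverse of a push, so the letter itself
  pushes right whatever its sign.\<close>

lemma exists_push_letter:
  fixes l c d r :: real
  assumes "l < c" "c < r" "d < r"
  obtains k where "k \<in> carrier Diff_plus" "\<And>y. y \<le> l \<or> r \<le> y \<Longrightarrow> k y = y"
    "\<And>y. y \<le> letter_act (\<lambda>_. k) a y" "d \<le> letter_act (\<lambda>_. k) a c"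
proof -
  obtain k where k: "k \<in> carrier Diff_plus" "\<And>y. y \<le> l \<or> r \<le> y \<Longrightarrow> k y = y"
    "\<And>y. y \<le> k y" "d \<le> k c"
    using exists_push_diffeo[OF assms] by blast
  have "bij k" by (rule Diff_plus_bij[OF k(1)])
  show ?thesis
  proof (cases "snd a")
    case True
    with k that show ?thesis by (simp add: letter_act_def)
  next
    case False
    have "inv_into UNIV (inv_into UNIV k) = k" by (rule inv_inv_eq[OF \<open>bij k\<close>])
    moreover have "inv_into UNIV k y = y" if "y \<le> l \<or> r \<le> y" for y
      using k(2)[OF that] \<open>bij k\<close> by (metis bij_is_inj inv_f_eq)
    ultimately show ?thesis
      using that[of "inv_into UNIV k"] k False Diff_plus_inv by (simp add: letter_act_def)
  qed
qed

section \<open>Combinatorics of reduced words\<close>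

definition reduced :: "'a set set \<Rightarrow> 'a word \<Rightarrow> bool" where
  "reduced E w \<longleftrightarrow>
    \<not> (\<exists>u a d m v. w = u @ (a, d) # m @ (a, \<not> d) # v \<and> (\<forall>l\<in>set m. {a, fst l} \<in> E))"

lemma reduced_tl: "reduced E (l # w) \<Longrightarrow> reduced E w"
  unfolding reduced_def by (metis append_Cons)

text \<open>A forbidden pattern starting at \<open>s\<close> stays forbidden when \<open>t\<close>
  is put back, since \<open>t\<close> may join the middle block. This lets the construction skip a
  letter that fixes the current point.\<close>

lemma reduced_delete_second:
  assumes "reduced E ((s, b) # (t, c) # w)" "{s, t} \<in> E"
  shows "reduced E ((s, b) # w)"
  unfolding reduced_def
proof clarify
  fix u a d m v
  assume eq: "(s, b) # w = u @ (a, d) # m @ (a, \<not> d) # v" and m: "\<forall>l\<in>set m. {a, fst l} \<in> E"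
  show False
  proof (cases u)
    case Nil
    with eq have "(s, b) # (t, c) # w = [] @ (a, d) # ((t, c) # m) @ (a, \<not> d) # v" "a = s"
      by auto
    moreover have "\<forall>l\<in>set ((t, c) # m). {a, fst l} \<in> E"
      using m assms(2) \<open>a = s\<close> by auto
    ultimately show False
      using assms(1) unfolding reduced_def by blast
  next
    case (Cons z u')
    with eq have "(s, b) # (t, c) # w = ((s, b) # (t, c) # u') @ (a, d) # m @ (a, \<not> d) # v"
      by auto
    then show False using m assms(1) unfolding reduced_def by blast
  qed
qed

lemma reduced_same_sign: "reduced E ((s, b) # (s, c) # w) \<Longrightarrow> c = b"
proof (rule ccontr)
  assume r: "reduced E ((s, b) # (s, c) # w)" and "c \<noteq> b"
  then have "(s, b) # (s, c) # w = [] @ (s, b) # [] @ (s, \<not> b) # w"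
    by auto
  then show False using r unfolding reduced_def by (metis empty_iff list.set(1))
qed

text \<open>Reversal turns a forbidden pattern into one with the opposite sign.\<close>

lemma reduced_rev:
  assumes "reduced E w"
  shows "reduced E (rev w)"
  unfolding reduced_def
proof clarify
  fix u a d m v
  assume eq: "rev w = u @ (a, d) # m @ (a, \<not> d) # v" and m: "\<forall>l\<in>set m. {a, fst l} \<in> E"
  from eq have "w = rev v @ (a, \<not> d) # rev m @ (a, \<not> \<not> d) # rev u"
    by (metis (no_types, lifting) append.assoc append_Cons append_Nil rev.simps(2) rev_append rev_rev_ident)
  moreover have "\<forall>l\<in>set (rev m). {a, fst l} \<in> E" using m by simp
  ultimately show False using assms unfolding reduced_def by blast
qed

section \<open>Following a trajectory through a chain of bumps\<close>

definition RAAG_family :: "'a set set \<Rightarrow> ('a \<Rightarrow> real \<Rightarrow> real) \<Rightarrow> real \<Rightarrow> real \<Rightarrow> bool" where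
  "RAAG_family E F p B \<longleftrightarrow> (\<forall>v. F v \<in> carrier Diff_plus) \<and>
    (\<forall>v y. y \<le> p \<or> B \<le> y \<longrightarrow> F v y = y) \<and> (\<forall>u v. {u, v} \<in> E \<longrightarrow> F u \<circ> F v = F v \<circ> F u)"

text \<open>Here \<open>a\<close> is the letter whose bump was applied last, the current point lies in \<open>{x..<r}\<close>, where
  \<open>r\<close> is the right end of that bump, and everything left of \<open>p\<close> belongs to earlier bumps. The
  family \<open>F\<close> collects only the bumps still to come. The final family \<open>H\<close> differs from it by the
  earlier ones, which is why \<open>H\<close> is compared with \<open>F\<close> on right half-lines only.\<close>

definition guided ::
  "('a \<Rightarrow> real \<Rightarrow> real) \<Rightarrow> ('a \<Rightarrow> real \<Rightarrow> real) \<Rightarrow> 'a \<times> bool \<Rightarrow> real \<Rightarrow> real \<Rightarrow> real \<Rightarrow> bool" where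
  "guided H F a p x r \<longleftrightarrow> (\<forall>v. bij (H v)) \<and> (\<forall>v y. v \<noteq> fst a \<longrightarrow> p < y \<longrightarrow> H v y = F v y) \<and>
    (\<forall>y\<ge>r. H (fst a) y = F (fst a) y) \<and>
    (\<forall>y. x \<le> y \<longrightarrow> y < r \<longrightarrow> y \<le> letter_act H a y \<and> letter_act H a y < r)"

text \<open>Triviality of these generators up to \<open>r\<close> leaves room for the bump of
  \<open>a\<close>: it can be composed with \<open>F (fst a)\<close> on a disjoint support, and it
  commutes with every adjacent generator. Quantifying over \<open>H\<close> makes the statement
  inductive, because the earlier bumps are added only afterwards.\<close>

definition continues :: "'a set set \<Rightarrow> ('a \<Rightarrow> real \<Rightarrow> real) \<Rightarrow> 'a \<times> bool \<Rightarrow> 'a word \<Rightarrow>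
    real \<Rightarrow> real \<Rightarrow> real \<Rightarrow> real \<Rightarrow> bool" where
  "continues E F a w p x r B \<longleftrightarrow> RAAG_family E F p B \<and>
    (\<forall>v y. v = fst a \<or> {fst a, v} \<in> E \<longrightarrow> y \<le> r \<longrightarrow> F v y = y) \<and>
    (\<forall>H x'. guided H F a p x r \<longrightarrow> x \<le> x' \<longrightarrow> x' < r \<longrightarrow> x \<le> fold (letter_act H) w x')"

lemma disjoint_supports_commute:
  fixes f g :: "real \<Rightarrow> real"
  assumes "strict_mono f" "strict_mono g" "\<And>y. r \<le> y \<Longrightarrow> f y = y" "\<And>y. y \<le> r \<Longrightarrow> g y = y"
  shows "f \<circ> g = g \<circ> f"
proof
  fix y
  show "(f \<circ> g) y = (g \<circ> f) y"
  proof (cases "y \<le> r")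
    case True
    then have "f y \<le> f r" using assms(1) by (simp add: strict_mono_less_eq)
    then show ?thesis using True assms(3)[of r] assms(4) by simp
  next
    case False
    then have "g r \<le> g y" using assms(2) by (simp add: strict_mono_less_eq)
    then show ?thesis using False assms(3) assms(4)[of r] by simp
  qed
qed

text \<open>This installs a new bump for \<open>a\<close>. It serves both at the start of the word
  and when the trajectory passes to a new generator; in the latter case \<open>r\<close> is the
  right end of the previous bump, which \<open>H\<close> may still contain.\<close>

lemma continues_extend:
  assumes irrefl: "\<And>v. {v} \<notin> E" and px: "p < x" "x < r" "r < B"
    and IH: "\<And>p x r. p < x \<Longrightarrow> x < r \<Longrightarrow> r < B \<Longrightarrow> \<exists>G. continues E G a w p x r B"
  shows "\<exists>F. RAAG_family E F p B \<and> (\<forall>v y. v \<noteq> fst a \<longrightarrow> y \<le> r \<longrightarrow> F v y = y) \<and>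
    (\<forall>H x'. (\<forall>v. bij (H v)) \<longrightarrow> (\<forall>y>p. H (fst a) y = F (fst a) y) \<longrightarrow>
      (\<forall>v. \<forall>y\<ge>r. H v y = F v y) \<longrightarrow> x \<le> x' \<longrightarrow> x' < r \<longrightarrow> r < fold (letter_act H) (a # w) x')"
proof -
  define t where "t = fst a"
  \<comment> \<open>The order is p < q < x < r < z < r' < B. The new bump lives on [q, r'] and
    carries \<open>x\<close> to \<open>z\<close> or beyond, past the previous bump; all later bumps
    lie to the right of \<open>r\<close>.\<close>
  obtain r' where r': "r < r'" "r' < B" using px dense by blast
  obtain z where z: "r < z" "z < r'" using r' dense by blast
  obtain q where q: "p < q" "q < x" using px dense by blast
  obtain G where G: "continues E G a w r z r' B"
    using IH[OF z r'(2)] by blast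
  have Gc: "G v \<in> carrier Diff_plus" and Gid: "y \<le> r \<or> B \<le> y \<Longrightarrow> G v y = y"
    and Gcomm: "{u, v} \<in> E \<Longrightarrow> G u \<circ> G v = G v \<circ> G u" for u v y
    using G by (auto simp: continues_def RAAG_family_def)
  have Glow: "v = t \<or> {t, v} \<in> E \<Longrightarrow> y \<le> r' \<Longrightarrow> G v y = y" for v y
    using G by (auto simp: continues_def t_def)
  obtain k where k: "k \<in> carrier Diff_plus" "\<And>y. y \<le> q \<or> r' \<le> y \<Longrightarrow> k y = y"
    "\<And>y. y \<le> letter_act (\<lambda>_. k) a y" "z \<le> letter_act (\<lambda>_. k) a x"
    using exists_push_letter[of q x r' z a] q(2) less_trans[OF px(2) r'(1)] z(2) by metis
  define k' where "k' = letter_act (\<lambda>_. k) a"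
  have k': "k' \<in> carrier Diff_plus"
    unfolding k'_def by (rule letter_act_Diff_plus) (rule k(1))
  have monok: "k y < k y' \<longleftrightarrow> y < y'" "k' y < k' y' \<longleftrightarrow> y < y'" for y y'
    using Diff_plus_strict_mono k(1) k' by (simp_all add: strict_mono_less)
  have k'r: "k' r' = r'"
    unfolding k'_def by (rule letter_act_fixed) (simp_all add: k Diff_plus_bij)
  have k'_lt: "k' y < r'" if "y < r'" for y
    using monok(2)[of y r'] that k'r by simp
  have k_le: "k y \<le> r'" if "y \<le> r'" for y
    using monok(1)[of r' y] that k(2)[of r'] by simp
  \<comment> \<open>\<open>G t\<close> is the identity up to \<open>r'\<close> and \<open>k\<close>
    is the identity from \<open>r'\<close> on, so the generator \<open>t\<close> carries both
    without interference.\<close>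
  define F where "F = G(t := G t \<circ> k)"
  have comm_t: "F t \<circ> F v = F v \<circ> F t" if "{t, v} \<in> E" for v
  proof -
    have "v \<noteq> t" using that irrefl[of t] by auto
    have 1: "k \<circ> G v = G v \<circ> k"
      by (rule disjoint_supports_commute[of _ _ r'])
        (use k Gc Diff_plus_strict_mono Glow that in auto)
    have "G t \<circ> k \<circ> G v = G t \<circ> G v \<circ> k"
      by (simp add: comp_assoc 1)
    also have "\<dots> = G v \<circ> (G t \<circ> k)"
      using Gcomm[OF that] by (simp add: comp_assoc)
    finally show ?thesis
      using \<open>v \<noteq> t\<close> by (simp add: F_def)
  qed
  have comm: "F u \<circ> F v = F v \<circ> F u" if "{u, v} \<in> E" for u v
  proof (cases "u = t \<or> v = t")
    case True
    then show ?thesis using comm_t[of u] comm_t[of v] that by (metis insert_commute)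
  next
    case False
    then show ?thesis using Gcomm[OF that] by (simp add: F_def)
  qed
  have fam: "RAAG_family E F p B"
    unfolding RAAG_family_def
  proof (intro conjI allI impI)
    show "F v \<in> carrier Diff_plus" for v
      using Gc k(1) by (simp add: F_def Diff_plus_comp)
    show "F v y = y" if "y \<le> p \<or> B \<le> y" for v y
    proof -
      have "k y = y" "G u y = y" for u
        using that k(2)[of y] Gid[of y u] q px r' by auto
      then show ?thesis by (simp add: F_def)
    qed
  qed (rule comm)
  have low: "F v y = y" if "v \<noteq> t" "y \<le> r" for v y
    using that Gid by (simp add: F_def)
  have "r < fold (letter_act H) (a # w) x'"
    if bij: "\<And>v. bij (H v)" and Ht: "\<And>y. p < y \<Longrightarrow> H t y = F t y"
      and Hv: "\<And>v y. r \<le> y \<Longrightarrow> H v y = F v y" and x': "x \<le> x'" "x' < r" for H x'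
  proof -
    have Hk: "H t y = k y" if "p < y" "y \<le> r'" for y
      using Ht[OF that(1)] Glow[of t "k y"] k_le[OF that(2)] by (simp add: F_def)
    have act: "letter_act H a y = k' y" if "x \<le> y" "y < r'" for y
    proof (cases "snd a")
      case True
      then show ?thesis using Hk[of y] that px by (simp add: letter_act_def k'_def t_def)
    next
      case False
      \<comment> \<open>\<open>H t\<close> is known only to the right of \<open>p\<close>, so its
        inverse is found by checking the candidate \<open>k' y\<close>, which lies in [y,
        r').\<close>
      have "H t (k' y) = k (k' y)"
        using Hk[of "k' y"] k(3)[of y] k'_lt[OF that(2)] that px by (simp add: k'_def)
      also have "\<dots> = y"
        using False Diff_plus_bij[OF k(1)]
        by (simp add: k'_def letter_act_def bij_is_surj surj_f_inv_f)
      finally show ?thesis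
        using False bij[of t] by (simp add: letter_act_def t_def bij_is_inj inv_f_eq)
    qed
    have "k' x \<le> k' x'"
      using monok(2)[of x' x] x' by simp
    then have "z \<le> letter_act H a x'" "letter_act H a x' < r'"
      using act[of x'] x' r' k(4) k'_lt[of x'] by (auto simp: k'_def)
    moreover have "guided H G a r z r'"
      unfolding guided_def
    proof (intro conjI allI impI)
      show "H v y = G v y" if "v \<noteq> fst a" "r < y" for v y
        using Hv[of y v] that by (simp add: F_def t_def)
      show "H (fst a) y = G (fst a) y" if "r' \<le> y" for y
        using Hv[of y t] that r' k(2)[of y] by (simp add: F_def t_def)
      show "y \<le> letter_act H a y" "letter_act H a y < r'" if "z \<le> y" "y < r'" for y
        using act[of y] k(3)[of y] k'_lt[of y] that z px by (auto simp: k'_def)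
    qed (rule bij)
    ultimately have "z \<le> fold (letter_act H) w (letter_act H a x')"
      using G by (simp add: continues_def)
    then show ?thesis using z by simp
  qed
  with fam low show ?thesis
    unfolding t_def by (intro exI[of _ F]) blast
qed

text \<open>Induction on the remaining word, split by how its first letter relates to
  \<open>a\<close>. Only a letter that is distinct from and not adjacent to \<open>a\<close>
  requires a new bump.\<close>

lemma exists_continues:
  assumes irrefl: "\<And>v. {v} \<notin> E"
  shows "reduced E (a # w) \<Longrightarrow> p < x \<Longrightarrow> x < r \<Longrightarrow> r < B \<Longrightarrow> \<exists>F. continues E F a w p x r B"
proof (induction w arbitrary: a p x r)
  case Nil
  have "continues E (\<lambda>_. id) a [] p x r B"
    by (simp add: continues_def RAAG_family_def Diff_plus_id)
  then show ?case by blast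
next
  case (Cons l w)
  obtain s b t c where a: "a = (s, b)" and l: "l = (t, c)" by fastforce
  consider "t = s" | "{s, t} \<in> E" "t \<noteq> s" | "{s, t} \<notin> E" "t \<noteq> s" by blast
  then show ?case
  proof cases
    case 1
    \<comment> \<open>Reducedness excludes the opposite sign, so the letter pushes right again
      within the same bump.\<close>
    have "l = a"
      using Cons.prems(1) 1 reduced_same_sign[of E s b c w] by (simp add: a l)
    obtain F where F: "continues E F a w p x r B"
      using Cons.IH[of a p x r] Cons.prems reduced_tl \<open>l = a\<close> by blast
    have "x \<le> fold (letter_act H) (l # w) x'"
      if "guided H F a p x r" "x \<le> x'" "x' < r" for H x'
    proof -
      have "x' \<le> letter_act H a x'" "letter_act H a x' < r"
        using that by (auto simp: guided_def)
      then show ?thesis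
        using F that \<open>l = a\<close> by (auto simp: continues_def)
    qed
    then have "continues E F a (l # w) p x r B"
      using F unfolding continues_def by blast
    then show ?thesis by blast
  next
    case 2
    \<comment> \<open>The adjacent letter fixes the current point, so the family for the word
      without it also works.\<close>
    obtain F where F: "continues E F a w p x r B"
      using Cons.IH[of a p x r] Cons.prems reduced_delete_second 2 a l by metis
    have "x \<le> fold (letter_act H) (l # w) x'"
      if "guided H F a p x r" "x \<le> x'" "x' < r" for H x'
    proof -
      have "bij (H t)" "H t x' = F t x'"
        using that Cons.prems 2 by (auto simp: guided_def a)
      moreover have "F t x' = x'"
        using F that 2 by (auto simp: continues_def a)
      ultimately have "letter_act H l x' = x'"
        by (simp add: letter_act_fixed l)
      then show ?thesis
        using F that by (auto simp: continues_def)
    qed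
    then have "continues E F a (l # w) p x r B"
      using F unfolding continues_def by blast
    then show ?thesis by blast
  next
    case 3
    have "reduced E (l # w)"
      using Cons.prems(1) reduced_tl by blast
    then have IH: "\<exists>F. continues E F l w p x r B" if "p < x" "x < r" "r < B" for p x r
      using Cons.IH that by blast
    obtain F where F: "RAAG_family E F p B" "\<And>v y. v \<noteq> t \<Longrightarrow> y \<le> r \<Longrightarrow> F v y = y"
      "\<And>H x'. (\<forall>v. bij (H v)) \<Longrightarrow> (\<forall>y>p. H t y = F t y) \<Longrightarrow>
        (\<forall>v. \<forall>y\<ge>r. H v y = F v y) \<Longrightarrow> x \<le> x' \<Longrightarrow> x' < r \<Longrightarrow> r < fold (letter_act H) (l # w) x'"
      using continues_extend[where a = l and w = w and E = E and B = B, OF irrefl Cons.prems(2-4) IH]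
      unfolding l fst_conv by blast
    have "x \<le> fold (letter_act H) (l # w) x'"
      if "guided H F a p x r" "x \<le> x'" "x' < r" for H x'
    proof -
      have "r < fold (letter_act H) (l # w) x'"
      proof (rule F(3))
        show "\<forall>v. \<forall>y\<ge>r. H v y = F v y"
        proof (intro allI impI)
          show "H v y = F v y" if "r \<le> y" for v y
            using \<open>guided H F a p x r\<close> Cons.prems that by (cases "v = s") (auto simp: guided_def a)
        qed
      qed (use that 3 in \<open>auto simp: guided_def a\<close>)
      then show ?thesis using Cons.prems by linarith
    qed
    \<comment> \<open>As \<open>t\<close> is neither \<open>s\<close> nor adjacent to
      \<open>s\<close>, the generators in question all differ from \<open>t\<close>, and the new
      bump is not theirs.\<close>
    moreover have "F v y = y" if "v = s \<or> {s, v} \<in> E" "y \<le> r" for v y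
      using that F(2)[of v y] 3 by auto
    ultimately have "continues E F a (l # w) p x r B"
      using F(1) by (simp add: continues_def a)
    then show ?thesis by blast
  qed
qed

lemma reduced_word_acts_nontrivially:
  assumes irrefl: "\<And>v. {v} \<notin> E" and "reduced E w" "w \<noteq> []"
  obtains F x where "RAAG_family E F (1/4) (3/4)" "0 \<le> x" "x < 1" "fold (letter_act F) w x \<noteq> x"
proof -
  obtain a w' where w: "w = a # w'" using assms(3) by (cases w) auto
  have IH: "\<exists>F. continues E F a w' p x r (3/4)" if "p < x" "x < r" "r < 3/4" for p x r
    using exists_continues[OF irrefl] assms(2) that unfolding w by blast
  obtain F where F: "RAAG_family E F (1/4) (3/4)"
    and push: "(\<forall>v. bij (F v)) \<Longrightarrow> 1/2 < fold (letter_act F) (a # w') (3/8)"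
    using continues_extend[where p = "1/4" and x = "3/8" and r = "1/2" and B = "3/4", OF irrefl _ _ _ IH]
    by fastforce
  have "\<forall>v. bij (F v)"
    using F by (simp add: RAAG_family_def Diff_plus_bij)
  with push have "1/2 < fold (letter_act F) w (3/8)" by (simp add: w)
  then show ?thesis
    using that[OF F, of "3/8"] by linarith
qed

section \<open>Gluing countably many actions\<close>

definition glue :: "(int \<Rightarrow> real \<Rightarrow> real) \<Rightarrow> real \<Rightarrow> real" where
  "glue F x = of_int \<lfloor>x\<rfloor> + F \<lfloor>x\<rfloor> (x - of_int \<lfloor>x\<rfloor>)"

lemma glue_block: "0 \<le> y \<Longrightarrow> y < 1 \<Longrightarrow> glue F (of_int n + y) = of_int n + F n y"
proof -
  assume "0 \<le> y" "y < 1"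
  then have "\<lfloor>of_int n + y\<rfloor> = n" by linarith
  then show ?thesis by (simp add: glue_def)
qed

text \<open>Near an integer the glued map is the identity, thanks to the margins outside [1/4, 3/4];
  elsewhere it is locally a translate of one \<open>F n\<close>.\<close>

lemma glue_Diff_plus:
  assumes F: "\<And>n. F n \<in> carrier Diff_plus" and id: "\<And>n y. y \<le> 1/4 \<or> 3/4 \<le> y \<Longrightarrow> F n y = y"
  shows "glue F \<in> carrier Diff_plus"
proof -
  have loc: "\<exists>g. smooth g \<and> deriv g x > 0 \<and> eventually (\<lambda>y. glue F y = g y) (nhds x)" for x
  proof (cases "x = of_int \<lfloor>x\<rfloor>")
    case True
    define n where "n = \<lfloor>x\<rfloor>"
    have "glue F y = y" if "y \<in> {of_int n - 1/4<..<of_int n + 1/4}" for y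
    proof (cases "of_int n \<le> y")
      case True
      then show ?thesis using glue_block[of "y - of_int n" F n] id[of "y - of_int n" n] that by auto
    next
      case False
      then show ?thesis
        using glue_block[of "y - of_int (n - 1)" F "n - 1"] id[of "y - of_int (n - 1)" "n - 1"] that
        by auto
    qed
    moreover have "eventually (\<lambda>y. y \<in> {of_int n - 1/4<..<of_int n + 1/4}) (nhds x)"
      using True by (intro eventually_nhds_in_open) (auto simp: n_def)
    ultimately have "eventually (\<lambda>y. glue F y = y) (nhds x)"
      by (auto elim: eventually_mono)
    then show ?thesis
      by (intro exI[of _ "\<lambda>y. y"]) (simp add: smooth_ident)
  next
    case False
    define n where "n = \<lfloor>x\<rfloor>"
    define g where "g = (\<lambda>y. (F n \<circ> (\<lambda>y. 1 * y + - of_int n)) y + of_int n)"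
    have Fn: "smooth (F n)" "\<And>y. deriv (F n) y > 0"
      using F[of n] by (auto simp: Diff_plus_def diffeomorphism_def orientation_preserving_def)
    have "smooth g"
      unfolding g_def by (intro smooth_add smooth_compose smooth_affine smooth_const Fn)
    moreover have "(g has_real_derivative deriv (F n) (x - of_int n)) (at x)"
      unfolding g_def o_def
      by (auto intro!: derivative_eq_intros smooth_has_derivative[OF Fn(1), THEN DERIV_chain2])
    then have "deriv g x > 0"
      using Fn(2) DERIV_imp_deriv by metis
    moreover have "eventually (\<lambda>y. y \<in> {of_int n<..<of_int n + 1}) (nhds x)"
      using False unfolding n_def by (intro eventually_nhds_in_open) (simp, simp, linarith)
    then have "eventually (\<lambda>y. glue F y = g y) (nhds x)"
    proof eventually_elim
      case (elim y)
      then show ?case using glue_block[of "y - of_int n" F n] by (simp add: g_def)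
    qed
    ultimately show ?thesis by blast
  qed
  have fixed: "glue F (of_int n) = of_int n" for n
    using glue_block[of 0 F n] id[of 0 n] by simp
  show ?thesis
  proof (rule Diff_plusI_fixpoints)
    show "smooth (glue F)"
      by (rule smooth_local) (use loc in blast)
    show "deriv (glue F) x > 0" for x
      using loc[of x] deriv_cong_ev[OF _ HOL.refl] by metis
    show "\<exists>a\<le>y. glue F a = a" for y
      using fixed[of "\<lfloor>y\<rfloor>"] of_int_floor_le by blast
    show "\<exists>a\<ge>y. glue F a = a" for y
      using fixed[of "\<lceil>y\<rceil>"] le_of_int_ceiling by blast
  qed
qed

text \<open>Every letter preserves the unit block, so a whole word acts block by block.\<close>

lemma fold_letter_act_glue:
  assumes F: "\<And>n v. F n v \<in> carrier Diff_plus"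
    and id: "\<And>n v y. y \<le> 1/4 \<or> 3/4 \<le> y \<Longrightarrow> F n v y = y"
    and y: "0 \<le> y" "y < 1"
  shows "fold (letter_act (\<lambda>v. glue (\<lambda>n. F n v))) w (of_int n + y) =
    of_int n + fold (letter_act (F n)) w y"
  using y
proof (induction w arbitrary: y)
  case (Cons l w)
  have G: "glue (\<lambda>n. F n v) \<in> carrier Diff_plus" for v
    by (rule glue_Diff_plus) (simp_all add: F id)
  have "letter_act (F n) l \<in> carrier Diff_plus"
    by (rule letter_act_Diff_plus) (rule F)
  then have "letter_act (F n) l 0 \<le> letter_act (F n) l y" "letter_act (F n) l y < letter_act (F n) l 1"
    using Diff_plus_strict_mono Cons.prems by (auto simp: strict_mono_less strict_mono_less_eq)
  moreover have "letter_act (F n) l 0 = 0" "letter_act (F n) l 1 = 1"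
    by (auto intro!: letter_act_fixed Diff_plus_bij F id)
  ultimately have range: "0 \<le> letter_act (F n) l y" "letter_act (F n) l y < 1" by auto
  have "letter_act (\<lambda>v. glue (\<lambda>n. F n v)) l (of_int n + y) = of_int n + letter_act (F n) l y"
  proof (cases "snd l")
    case True
    then show ?thesis using Cons.prems by (simp add: letter_act_def glue_block)
  next
    case False
    have "glue (\<lambda>n. F n (fst l)) (of_int n + letter_act (F n) l y) = of_int n + y"
      using range False by (simp add: glue_block letter_act_def surj_f_inv_f[OF bij_is_surj[OF Diff_plus_bij[OF F]]])
    then show ?thesis
      using False Diff_plus_bij[OF G] by (simp add: letter_act_def bij_is_inj inv_f_eq)
  qed
  with Cons.IH[OF range] show ?case by simp
qed simp

lemma glue_commute:
  assumes F: "\<And>n. F n \<in> carrier Diff_plus" "\<And>n. G n \<in> carrier Diff_plus"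
    and id: "\<And>n y. y \<le> 1/4 \<or> 3/4 \<le> y \<Longrightarrow> F n y = y" "\<And>n y. y \<le> 1/4 \<or> 3/4 \<le> y \<Longrightarrow> G n y = y"
    and comm: "\<And>n. F n \<circ> G n = G n \<circ> F n"
  shows "glue F \<circ> glue G = glue G \<circ> glue F"
proof
  fix x :: real
  define n where "n = \<lfloor>x\<rfloor>"
  define y where "y = x - of_int \<lfloor>x\<rfloor>"
  have x: "x = of_int n + y" "0 \<le> y" "y < 1" unfolding n_def y_def by linarith+
  have "H 0 \<le> H y" "H y < H 1" if "H \<in> carrier Diff_plus" for H
    using Diff_plus_strict_mono[OF that] x by (auto simp: strict_mono_less strict_mono_less_eq)
  from this[of "F n"] this[of "G n"] have "0 \<le> F n y" "F n y < 1" "0 \<le> G n y" "G n y < 1"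
    using F id[of 0] id[of 1] by auto
  then show "(glue F \<circ> glue G) x = (glue G \<circ> glue F) x"
    using x comm[of n] by (simp add: glue_block fun_eq_iff)
qed

section \<open>Homomorphisms from presented groups\<close>

text \<open>\<open>foldr\<close> turns concatenation into composition, as a homomorphism to
  \<open>Diff_plus\<close> requires. The last letter then acts first, whereas trajectories were
  followed with \<open>fold\<close>; this is why words get reversed later.\<close>

lemma foldr_letter_act_append:
  "foldr (letter_act f) (u @ v) = foldr (letter_act f) u \<circ> foldr (letter_act f) v"
  by (simp add: fun_eq_iff)

lemma foldr_letter_act_Diff_plus:
  "(\<And>v. f v \<in> carrier Diff_plus) \<Longrightarrow> foldr (letter_act f) w \<in> carrier Diff_plus"
  by (induction w) (simp_all only: foldr.simps Diff_plus_id Diff_plus_comp letter_act_Diff_plus)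

lemma pres_rel_letter_act:
  assumes "\<And>v. bij (f v)" "\<And>r. r \<in> R \<Longrightarrow> foldr (letter_act f) r = id"
    and "(w, w') \<in> pres_rel S R"
  shows "foldr (letter_act f) w = foldr (letter_act f) w'"
  using assms(3)
proof (induction rule: pres_rel.induct)
  case (cancel u v s b)
  have "letter_act f (s, b) \<circ> letter_act f (s, \<not> b) = id"
    using assms(1)[of s] by (auto simp: letter_act_def fun_eq_iff bij_is_surj surj_f_inv_f bij_is_inj)
  then have "foldr (letter_act f) [(s, b), (s, \<not> b)] = id"
    by (simp add: fun_eq_iff)
  then show ?case by (simp only: foldr_letter_act_append id_comp)
next
  case (relator u v r)
  then show ?case by (simp only: foldr_letter_act_append assms(2) id_comp)
qed simp_all

text \<open>The universal property of a presentation. Defining the map through a chosen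
  representative is harmless by \<open>pres_rel_letter_act\<close>.\<close>

lemma presented_group_hom_Diff_plus:
  assumes f: "\<And>v. f v \<in> carrier Diff_plus"
    and rel: "\<And>r. r \<in> R \<Longrightarrow> foldr (letter_act f) r = id"
  obtains \<phi> where "\<phi> \<in> hom (presented_group S R) Diff_plus"
    "\<And>w. w \<in> words S \<Longrightarrow> \<phi> (pres_rel S R `` {w}) = foldr (letter_act f) w"
proof -
  define \<phi> where "\<phi> A = foldr (letter_act f) (SOME w. w \<in> A)" for A
  have \<phi>: "\<phi> (pres_rel S R `` {w}) = foldr (letter_act f) w" if "w \<in> words S" for w
  proof -
    have "w \<in> pres_rel S R `` {w}" using that by (simp add: pres_rel.refl)
    then have "(SOME w'. w' \<in> pres_rel S R `` {w}) \<in> pres_rel S R `` {w}" by (rule someI)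
    then show ?thesis
      using pres_rel_letter_act[of f R w _ S] f rel by (auto simp: \<phi>_def Diff_plus_bij)
  qed
  have "\<phi> \<in> hom (presented_group S R) Diff_plus"
  proof (rule homI)
    have carrier: "\<exists>w\<in>words S. A = pres_rel S R `` {w}" if "A \<in> carrier (presented_group S R)" for A
      using that by (auto simp: presented_group_def elim: quotientE)
    fix A assume "A \<in> carrier (presented_group S R)"
    then obtain u where u: "u \<in> words S" "A = pres_rel S R `` {u}" using carrier by blast
    then show "\<phi> A \<in> carrier Diff_plus"
      using foldr_letter_act_Diff_plus f \<phi> by metis
    fix B assume "B \<in> carrier (presented_group S R)"
    then obtain v where v: "v \<in> words S" "B = pres_rel S R `` {v}" using carrier by blast
    show "\<phi> (A \<otimes>\<^bsub>presented_group S R\<^esub> B) = \<phi> A \<otimes>\<^bsub>Diff_plus\<^esub> \<phi> B"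
      unfolding u(2) v(2) presented_mult[OF u(1) v(1)]
      by (simp add: \<phi> u(1) v(1) Diff_plus_def fun_eq_iff)
  qed
  with \<phi> that show ?thesis by blast
qed

section \<open>Rewriting to reduced words\<close>

lemma pres_rel_swap_inverse:
  assumes "([(a, d), l], [l, (a, d)]) \<in> pres_rel S R"
  shows "([(a, \<not> d), l], [l, (a, \<not> d)]) \<in> pres_rel S R"
proof -
  have w: "a \<in> S" "fst l \<in> S" using pres_rel_words[OF assms] by auto
  \<comment> \<open>Writing a for the letter \<open>(a, d)\<close>, the chain is a^-1 l = a^-1 l a
    a^-1 = a^-1 a l a^-1 = l a^-1.\<close>
  have 1: "([(a, \<not> d), l, (a, d), (a, \<not> d)], [(a, \<not> d), l]) \<in> pres_rel S R"
    using pres_rel.cancel[of "[(a, \<not> d), l]" S "[]" a d R] w by simp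
  have 2: "([(a, \<not> d), (a, d), l, (a, \<not> d)], [(a, \<not> d), l, (a, d), (a, \<not> d)]) \<in> pres_rel S R"
    using pres_rel_context[OF assms, of "[(a, \<not> d)]" "[(a, \<not> d)]"] w by simp
  have 3: "([(a, \<not> d), (a, d), l, (a, \<not> d)], [l, (a, \<not> d)]) \<in> pres_rel S R"
    using pres_rel.cancel[of "[]" S "[l, (a, \<not> d)]" a "\<not> d" R] w by simp
  from 1 2 3 show ?thesis by (blast intro: pres_rel.sym pres_rel.trans)
qed

lemma pres_rel_swap:
  assumes "a \<in> S" "b \<in> S" "commutator_word a b \<in> R"
  shows "([(a, d), (b, e)], [(b, e), (a, d)]) \<in> pres_rel S R"
proof -
  have c: "commutator_word a b \<in> words S"
    using assms by (simp add: commutator_word_def)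
  \<comment> \<open>The word a b a^-1 b^-1 b a reduces to b a by the relator and to a b by
    cancellation.\<close>
  have 1: "(commutator_word a b @ [(b, True), (a, True)], [(b, True), (a, True)]) \<in> pres_rel S R"
    using pres_rel.relator[of "[]" S "[(b, True), (a, True)]" _ R] assms c by simp
  have 2: "(commutator_word a b @ [(b, True), (a, True)], [(a, True), (b, True), (a, False), (a, True)])
      \<in> pres_rel S R"
    using pres_rel.cancel[of "[(a, True), (b, True), (a, False)]" S "[(a, True)]" b False R] assms
    by (simp add: commutator_word_def)
  have 3: "([(a, True), (b, True), (a, False), (a, True)], [(a, True), (b, True)]) \<in> pres_rel S R"
    using pres_rel.cancel[of "[(a, True), (b, True)]" S "[]" a False R] assms by simp
  have base: "([(a, True), (b, True)], [(b, True), (a, True)]) \<in> pres_rel S R"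
    using 1 2 3 by (blast intro: pres_rel.sym pres_rel.trans)
  have "([(a, d), (b, True)], [(b, True), (a, d)]) \<in> pres_rel S R"
    using base pres_rel_swap_inverse[OF base] by (cases d) auto
  then have "([(b, True), (a, d)], [(a, d), (b, True)]) \<in> pres_rel S R"
    by (rule pres_rel.sym)
  then have "([(b, e), (a, d)], [(a, d), (b, e)]) \<in> pres_rel S R"
    using pres_rel_swap_inverse[of b True] by (cases e) auto
  then show ?thesis by (rule pres_rel.sym)
qed

lemma pres_rel_move:
  assumes "a \<in> S" "m \<in> words S" "\<And>l. l \<in> set m \<Longrightarrow> commutator_word a (fst l) \<in> R"
  shows "((a, d) # m, m @ [(a, d)]) \<in> pres_rel S R"
  using assms(2,3)
proof (induction m)
  case (Cons l m)
  have "([(a, d), l], [l, (a, d)]) \<in> pres_rel S R"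
    using pres_rel_swap[of a S "fst l" R d "snd l"] assms(1) Cons.prems by simp
  then have 1: "((a, d) # l # m, l # (a, d) # m) \<in> pres_rel S R"
    using pres_rel_context[of _ _ S R "[]" m] Cons.prems by fastforce
  have "((a, d) # m, m @ [(a, d)]) \<in> pres_rel S R"
    using Cons by simp
  then have 2: "(l # (a, d) # m, l # m @ [(a, d)]) \<in> pres_rel S R"
    using pres_rel_context[of _ _ S R "[l]" "[]"] Cons.prems by fastforce
  from 1 2 show ?case by (auto intro: pres_rel.trans)
qed (use assms(1) in \<open>auto intro: pres_rel.refl\<close>)

text \<open>In a forbidden pattern the first letter can be moved across the middle block and
  cancelled, which shortens the word by two.\<close>

lemma exists_reduced_word:
  assumes R: "\<And>a b. {a, b} \<in> E \<Longrightarrow> commutator_word a b \<in> R"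
  shows "w \<in> words S \<Longrightarrow> \<exists>w'. (w, w') \<in> pres_rel S R \<and> reduced E w'"
proof (induction "length w" arbitrary: w rule: less_induct)
  case less
  show ?case
  proof (cases "reduced E w")
    case True
    then show ?thesis using less.prems pres_rel.refl by blast
  next
    case False
    then obtain u a d m v where w: "w = u @ (a, d) # m @ (a, \<not> d) # v"
      and m: "\<forall>l\<in>set m. {a, fst l} \<in> E"
      unfolding reduced_def by blast
    have W: "u \<in> words S" "a \<in> S" "m \<in> words S" "v \<in> words S"
      using less.prems by (auto simp: w)
    have "((a, d) # m, m @ [(a, d)]) \<in> pres_rel S R"
      using W m R by (intro pres_rel_move) auto
    then have "(w, u @ m @ (a, d) # (a, \<not> d) # v) \<in> pres_rel S R"
      using pres_rel_context[of _ _ S R u "(a, \<not> d) # v"] W by (fastforce simp: w)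
    moreover have "(u @ m @ (a, d) # (a, \<not> d) # v, u @ m @ v) \<in> pres_rel S R"
      using pres_rel.cancel[of "u @ m" S v a d R] W by simp
    ultimately have 1: "(w, u @ m @ v) \<in> pres_rel S R" by (rule pres_rel.trans)
    obtain w' where "(u @ m @ v, w') \<in> pres_rel S R" "reduced E w'"
      using less.hyps[of "u @ m @ v"] W by (auto simp: w)
    with 1 show ?thesis by (blast intro: pres_rel.trans)
  qed
qed

section \<open>Assembly of the embedding\<close>

theorem theorem1:
  fixes V :: "'a set" and E :: "'a set set"
  assumes "finite_simplicial_graph V E"
  shows "\<exists>\<phi>. \<phi> \<in> hom (RAAG V E) Diff_plus \<and> inj_on \<phi> (carrier (RAAG V E))"
proof -
  have irrefl: "{v} \<notin> E" for v
    using assms by (auto simp: finite_simplicial_graph_def)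
  define R where "R = {commutator_word a b | a b. {a, b} \<in> E}"
  \<comment> \<open>An enumeration of all words by the integers, matching the blocks of
    \<open>glue\<close>; negative indices merely repeat the word at 0.\<close>
  define W where "W n = from_nat_into (words V) (nat n)" for n
  have "countable (words V)"
    using assms unfolding words_def finite_simplicial_graph_def
    by (intro countable_lists countable_SIGMA countable_finite) auto
  then have W_onto: "\<exists>n. W n = w" if "w \<in> words V" for w
    using that from_nat_into_surj unfolding W_def by (metis nat_int)
  \<comment> \<open>Block n is devoted to detecting \<open>W n\<close>; words that are empty or not
    reduced get the identity family.\<close>
  have "\<exists>F. RAAG_family E F (1/4) (3/4) \<and> (reduced E (W n) \<longrightarrow> W n \<noteq> [] \<longrightarrow>
      (\<exists>y. 0 \<le> y \<and> y < 1 \<and> fold (letter_act F) (rev (W n)) y \<noteq> y))" for n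
  proof (cases "reduced E (W n) \<and> W n \<noteq> []")
    case True
    then show ?thesis
      using reduced_word_acts_nontrivially[OF irrefl, where w = "rev (W n)"] reduced_rev
      by (metis rev_is_Nil_conv)
  next
    case False
    moreover have "RAAG_family E (\<lambda>_. id) (1/4) (3/4)"
      by (simp add: RAAG_family_def Diff_plus_id)
    ultimately show ?thesis by blast
  qed
  then obtain F where fam: "\<And>n. RAAG_family E (F n) (1/4) (3/4)"
    and moves: "\<And>n. reduced E (W n) \<Longrightarrow> W n \<noteq> [] \<Longrightarrow>
      \<exists>y. 0 \<le> y \<and> y < 1 \<and> fold (letter_act (F n)) (rev (W n)) y \<noteq> y"
    by metis
  have F: "F n v \<in> carrier Diff_plus" "y \<le> 1/4 \<or> 3/4 \<le> y \<Longrightarrow> F n v y = y"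
    and F_comm: "{u, v} \<in> E \<Longrightarrow> F n u \<circ> F n v = F n v \<circ> F n u" for n u v y
    using fam[of n] by (auto simp: RAAG_family_def)
  define f where "f v = glue (\<lambda>n. F n v)" for v
  have f: "f v \<in> carrier Diff_plus" for v
    unfolding f_def by (rule glue_Diff_plus) (simp_all add: F)
  have rel: "foldr (letter_act f) r = id" if r_in: "r \<in> R" for r
  proof -
    obtain a b where r: "r = commutator_word a b" and ab: "{a, b} \<in> E"
      using r_in by (auto simp: R_def)
    have "f a \<circ> f b = f b \<circ> f a"
      unfolding f_def by (rule glue_commute) (simp_all add: F F_comm[OF ab])
    then have "f a (f b x) = f b (f a x)" for x
      by (simp add: fun_eq_iff)
    then show ?thesis
      by (simp add: r commutator_word_def letter_act_def fun_eq_iff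
          surj_f_inv_f[OF bij_is_surj[OF Diff_plus_bij[OF f]]])
  qed
  obtain \<phi> where hom: "\<phi> \<in> hom (presented_group V R) Diff_plus"
    and \<phi>: "\<And>w. w \<in> words V \<Longrightarrow> \<phi> (pres_rel V R `` {w}) = foldr (letter_act f) w"
    using presented_group_hom_Diff_plus[of f R V, OF f rel] by blast
  \<comment> \<open>Trivial kernel: a nonempty reduced representative would move a point of its own
    block.\<close>
  have "A = \<one>\<^bsub>presented_group V R\<^esub>"
    if A: "A \<in> carrier (presented_group V R)" "\<phi> A = \<one>\<^bsub>Diff_plus\<^esub>" for A
  proof -
    obtain u where u: "u \<in> words V" "A = pres_rel V R `` {u}"
      using A(1) by (auto simp: presented_group_def elim: quotientE)
    obtain w where w: "(u, w) \<in> pres_rel V R" "reduced E w"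
      using exists_reduced_word[of E R u V] u(1) by (auto simp: R_def)
    have wV: "w \<in> words V" and Aw: "A = pres_rel V R `` {w}"
      using pres_rel_words[OF w(1)] equiv_class_eq[OF equiv_pres_rel w(1)] u(2) by auto
    have triv: "foldr (letter_act f) w = id"
      using A(2) \<phi>[OF wV] by (simp add: Aw Diff_plus_def)
    obtain n where n: "W n = w" using W_onto[OF wV] by blast
    have "w = []"
    proof (rule ccontr)
      assume "w \<noteq> []"
      then obtain y where y: "0 \<le> y" "y < 1" "fold (letter_act (F n)) (rev w) y \<noteq> y"
        using moves[of n] n w(2) by auto
      have "fold (letter_act f) (rev w) (of_int n + y) = of_int n + fold (letter_act (F n)) (rev w) y"
        unfolding f_def by (rule fold_letter_act_glue) (simp_all add: F y)
      then show False
        using triv y(3) by (simp add: foldr_conv_fold)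
    qed
    then show ?thesis by (simp add: Aw presented_group_def)
  qed
  then have "inj_on \<phi> (carrier (presented_group V R))"
    by (simp add: inj_on_one_iff'[OF hom group_presented_group group_Diff_plus])
  then show ?thesis
    using hom unfolding RAAG_def R_def[symmetric] by blast
qed

end
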